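(* Let the vectors $\bm{s}_k$, $\tilde{\bm{s}}_k$, $\bm{u}_k$, $\tilde{\bm{u}}_k$ be generated by the transformation algorithm (Bi-CG with the smoothing scheme) described in the context, run without breakdown for the steps $k=0,\dots,m-1$, where $1\le m\le n$. Then $$(\bm{s}_i, A^\top\tilde{\bm{s}}_j)=0\quad\text{for all } i\ne j,\ 0\le i,j\le m,\ i,j<n,$$ $$(\bm{u}_i,\tilde{\bm{u}}_j)=0\quad\text{for all } i\neq j,\ 1\le i,j\le m.$$
   Context: $(\bm{x},\bm{y})=\bm{x}^\top\bm{y}$ is the standard inner product on $\mathbb{R}^n$. $A\in\mathbb{R}^{n\times n}$ is nonsymmetric and nonsingular, $\bm{b}\in\mathbb{R}^n$; all computations are in exact arithmetic. Transformation algorithm. Choose $\bm{x}_0\in\mathbb{R}^n$, set $\bm{r}_0=\bm{b}-A\bm{x}_0$, choose $\tilde{\bm{r}}_0\in\mathbb{R}^n$ with $(\tilde{\bm{r}}_0,\bm{r}_0)\ne 0$, and set $\bm{p}_0=\bm{r}_0$, $\tilde{\bm{p}}_0=\tilde{\bm{r}}_0$, $\bm{y}_0=\bm{x}_0$, $\bm{s}_0=\bm{r}_0$, $\tilde{\bm{s}}_0=\tilde{\bm{r}}_0$. Step $k$ ($k=0,1,\dots$) computes in order: - $\alpha_k=\dfrac{(\tilde{\bm{r}}_k,\bm{r}_k)}{(\tilde{\bm{p}}_k,A\bm{p}_k)}$, $\ \bm{x}_{k+1}=\bm{x}_k+\alpha_k\bm{p}_k$, - $\bm{r}_{k+1}=\bm{r}_k-\alpha_kA\bm{p}_k$,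 $\ \tilde{\bm{r}}_{k+1}=\tilde{\bm{r}}_k-\alpha_kA^\top\tilde{\bm{p}}_k$, - $\bm{u}_{k+1}=\bm{r}_{k+1}-\bm{s}_k$, $\ \tilde{\bm{u}}_{k+1}=\tilde{\bm{r}}_{k+1}-\tilde{\bm{s}}_k$, - $\eta_{k+1}=-\dfrac{(\tilde{\bm{s}}_k,\bm{u}_{k+1})+(\bm{s}_k,\tilde{\bm{u}}_{k+1})}{2(\tilde{\bm{u}}_{k+1},\bm{u}_{k+1})}$, - $\bm{y}_{k+1}=\bm{y}_k+\eta_{k+1}(\bm{x}_{k+1}-\bm{y}_k)$, $\ \bm{s}_{k+1}=\bm{s}_k+\eta_{k+1}\bm{u}_{k+1}$, $\ \tilde{\bm{s}}_{k+1}=\tilde{\bm{s}}_k+\eta_{k+1}\tilde{\bm{u}}_{k+1}$, - $\beta_k=\dfrac{(\tilde{\bm{r}}_{k+1},\bm{r}_{k+1})}{(\tilde{\bm{r}}_k,\bm{r}_k)}$, $\ \bm{p}_{k+1}=\bm{r}_{k+1}+\beta_k\bm{p}_k$, $\ \tilde{\bm{p}}_{k+1}=\tilde{\bm{r}}_{k+1}+\beta_k\tilde{\bm{p}}_k$. "Without breakdown for the steps $k=0,\dots,m-1$" means that all denominators are nonzero: $(\tilde{\bm{r}}_k,\bm{r}_k)\ne0$, $(\tilde{\bm{p}}_k,A\bm{p}_k)\ne0$ and $(\tilde{\bm{u}}_{k+1},\bm{u}_{k+1})\ne0$ for $0\le k\le m-1$. *)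

theory Defs
  imports "HOL-Analysis.Analysis"
begin

text \<open>Iterates of Bi-CG with smoothing; a trailing \<open>t\<close> marks the tilde (dual) vectors.\<close>

record 'v state =
  x :: 'v
  r :: 'v
  rt :: 'v
  u :: 'v
  ut :: 'v
  y :: 'v
  s :: 'v
  st :: 'v
  p :: 'v
  pt :: 'v

hide_const (open) x r rt u ut y s st p pt

text \<open>The algorithm defines \<open>u\<close> and \<open>ut\<close> only from index 1 on; their values at
  index 0 are placeholders and are never read.\<close>

definition init :: "real^'n^'n \<Rightarrow> real^'n \<Rightarrow> real^'n \<Rightarrow> real^'n \<Rightarrow> (real^'n) state" where
  "init A b x0 rt0 =
    (let r0 = b - A *v x0 in
     \<lparr>state.x = x0, r = r0, rt = rt0, u = 0, ut = 0,
      y = x0, s = r0, st = rt0, p = r0, pt = rt0\<rparr>)"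

definition step :: "real^'n^'n \<Rightarrow> (real^'n) state \<Rightarrow> (real^'n) state" where
  "step A \<sigma> =
    (let \<alpha> = (state.rt \<sigma> \<bullet> state.r \<sigma>) / (state.pt \<sigma> \<bullet> (A *v state.p \<sigma>));
         x' = state.x \<sigma> + \<alpha> *\<^sub>R state.p \<sigma>;
         r' = state.r \<sigma> - \<alpha> *\<^sub>R (A *v state.p \<sigma>);
         rt' = state.rt \<sigma> - \<alpha> *\<^sub>R (transpose A *v state.pt \<sigma>);
         u' = r' - state.s \<sigma>;
         ut' = rt' - state.st \<sigma>;
         \<eta> = - ((state.st \<sigma> \<bullet> u' + state.s \<sigma> \<bullet> ut') / (2 * (ut' \<bullet> u')));
         y' = state.y \<sigma> + \<eta> *\<^sub>R (x' - state.y \<sigma>);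
         s' = state.s \<sigma> + \<eta> *\<^sub>R u';
         st' = state.st \<sigma> + \<eta> *\<^sub>R ut';
         \<beta> = (rt' \<bullet> r') / (state.rt \<sigma> \<bullet> state.r \<sigma>);
         p' = r' + \<beta> *\<^sub>R state.p \<sigma>;
         pt' = rt' + \<beta> *\<^sub>R state.pt \<sigma>
     in \<lparr>state.x = x', r = r', rt = rt', u = u', ut = ut',
         y = y', s = s', st = st', p = p', pt = pt'\<rparr>)"

primrec iterate ::
  "real^'n^'n \<Rightarrow> real^'n \<Rightarrow> real^'n \<Rightarrow> real^'n \<Rightarrow> nat \<Rightarrow> (real^'n) state" where
  "iterate A b x0 rt0 0 = init A b x0 rt0"
| "iterate A b x0 rt0 (Suc k) = step A (iterate A b x0 rt0 k)"

text \<open>Since division by zero is total in HOL, the iterates past a breakdown are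
  meaningless; this predicate excludes breakdown in steps \<open>0, \<dots>, m - 1\<close>.\<close>

definition no_breakdown ::
  "real^'n^'n \<Rightarrow> real^'n \<Rightarrow> real^'n \<Rightarrow> real^'n \<Rightarrow> nat \<Rightarrow> bool" where
  "no_breakdown A b x0 rt0 m \<longleftrightarrow>
    (\<forall>k<m. let \<sigma> = iterate A b x0 rt0 k; \<sigma>' = iterate A b x0 rt0 (Suc k) in
       state.rt \<sigma> \<bullet> state.r \<sigma> \<noteq> 0 \<and>
       state.pt \<sigma> \<bullet> (A *v state.p \<sigma>) \<noteq> 0 \<and>
       state.ut \<sigma>' \<bullet> state.u \<sigma>' \<noteq> 0)"

end

theory Submission
  imports Defs
begin

text \<open>The smoothed residuals are multiples of the Bi-CG directions: writing \<open>\<rho>\<^sub>k = (rt\<^sub>k, r\<^sub>k)\<close>,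
  biorthogonality gives \<open>\<eta>\<^sub>k\<^sub>+\<^sub>1 = \<sigma>\<^sub>k / (\<rho>\<^sub>k\<^sub>+\<^sub>1 + \<sigma>\<^sub>k)\<close> with \<open>\<sigma>\<^sub>k = (st\<^sub>k, s\<^sub>k)\<close>, whence
  inductively \<open>s\<^sub>k = \<eta>\<^sub>k p\<^sub>k\<close>, \<open>st\<^sub>k = \<eta>\<^sub>k pt\<^sub>k\<close> (with \<open>\<eta>\<^sub>0 = 1\<close>), so the \<open>A\<close>-biorthogonality of
  the directions carries over to the \<open>s\<^sub>k\<close>. The choice of \<open>\<eta>\<^sub>k\<close> makes \<open>u\<^sub>k\<close> orthogonal to \<open>st\<^sub>k\<close>,
  hence to every later \<open>st\<^sub>j\<close> and \<open>rt\<^sub>j\<close>, and so to every later \<open>ut\<^sub>j\<close>.\<close>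

section \<open>Biorthogonality of the Bi-CG residuals and directions\<close>

locale bicg =
  fixes A At :: "'v::real_inner \<Rightarrow> 'v" and m :: nat
    and r rt p pt :: "nat \<Rightarrow> 'v" and \<alpha> \<beta> :: "nat \<Rightarrow> real"
  assumes adjoint: "v \<bullet> A w = At v \<bullet> w"
    and p_0: "p 0 = r 0" and pt_0: "pt 0 = rt 0"
    and r_Suc: "r (Suc k) = r k - \<alpha> k *\<^sub>R A (p k)"
    and rt_Suc: "rt (Suc k) = rt k - \<alpha> k *\<^sub>R At (pt k)"
    and p_Suc: "p (Suc k) = r (Suc k) + \<beta> k *\<^sub>R p k"
    and pt_Suc: "pt (Suc k) = rt (Suc k) + \<beta> k *\<^sub>R pt k"
    and alpha: "\<alpha> k = (rt k \<bullet> r k) / (pt k \<bullet> A (p k))"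
    and beta: "\<beta> k = (rt (Suc k) \<bullet> r (Suc k)) / (rt k \<bullet> r k)"
    and rho_nonzero: "k < m \<Longrightarrow> rt k \<bullet> r k \<noteq> 0"
    and pAp_nonzero: "k < m \<Longrightarrow> pt k \<bullet> A (p k) \<noteq> 0"
begin

text \<open>Exchanging plain and tilde sequences together with \<open>A\<close> and
  \<open>At\<close> preserves the recurrences and both coefficients, by symmetry of the inner
  product. Each one-sided orthogonality thus also yields its mirror image.\<close>

lemma dual: "bicg At A m rt r pt p \<alpha> \<beta>"
proof
  show "v \<bullet> At w = A v \<bullet> w" for v w
    by (metis adjoint inner_commute)
  show "\<alpha> k = (r k \<bullet> rt k) / (p k \<bullet> At (pt k))" for k
    by (metis alpha adjoint inner_commute)
  show "\<beta> k = (r (Suc k) \<bullet> rt (Suc k)) / (r k \<bullet> rt k)" for k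
    by (metis beta inner_commute)
  show "r k \<bullet> rt k \<noteq> 0" if "k < m" for k
    using rho_nonzero[OF that] by (simp add: inner_commute)
  show "p k \<bullet> At (pt k) \<noteq> 0" if "k < m" for k
    using pAp_nonzero[OF that] by (simp add: adjoint inner_commute)
qed (fact p_0 pt_0 r_Suc rt_Suc p_Suc pt_Suc)+

lemma alpha_mult: "k < m \<Longrightarrow> \<alpha> k * (pt k \<bullet> A (p k)) = rt k \<bullet> r k"
  using pAp_nonzero by (simp add: alpha)

lemma alpha_nonzero: "k < m \<Longrightarrow> \<alpha> k \<noteq> 0"
  using alpha_mult rho_nonzero by fastforce

lemma beta_mult: "k < m \<Longrightarrow> \<beta> k * (rt k \<bullet> r k) = rt (Suc k) \<bullet> r (Suc k)"
  using rho_nonzero by (simp add: beta)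

text \<open>The two relations feed each other and are proved jointly by induction on the larger
  index: the residual recurrence advances the first, the direction recurrence then the
  second.\<close>

lemma rt_r_and_pt_A_p_upper:
  assumes "k \<le> m" "i < k"
  shows "rt i \<bullet> r k = 0 \<and> pt i \<bullet> A (p k) = 0"
  using assms
proof (induction k arbitrary: i)
  case 0
  then show ?case by simp
next
  case (Suc k)
  have k: "k < m" using Suc.prems by simp
  have r0: "rt i \<bullet> r (Suc k) = 0" if "i \<le> k" for i
  proof -
    have IH: "rt i \<bullet> r k = 0 \<and> pt i \<bullet> A (p k) = 0" if "i < k" for i
      using Suc.IH that k by simp
    \<comment> \<open>Since \<open>rt i\<close> is \<open>pt i\<close> minus a multiple of its
      predecessor, only \<open>i = k\<close> survives; there the choice of \<open>\<alpha> k\<close>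
      cancels \<open>rt k \<bullet> r k\<close>.\<close>
    have "rt i \<bullet> A (p k) = (if i = k then pt k \<bullet> A (p k) else 0)"
    proof (cases i)
      case 0
      then show ?thesis using IH[of 0] by (auto simp flip: pt_0)
    next
      case (Suc l)
      have "rt i \<bullet> A (p k) = pt i \<bullet> A (p k) - \<beta> l * (pt l \<bullet> A (p k))"
        by (simp add: Suc pt_Suc inner_add_left)
      then show ?thesis using IH[of l] IH[of i] that Suc by auto
    qed
    then show ?thesis
      using IH[of i] that alpha_mult[OF k] by (auto simp: r_Suc inner_diff_right)
  qed
  \<comment> \<open>The factor \<open>\<alpha> i\<close>, nonzero and cancelled at the end, lets
    \<open>rt i - rt (Suc i)\<close> replace \<open>\<alpha> i *\<^sub>R At (pt i)\<close>. For
    \<open>i = k\<close> the remainder is absorbed by the \<open>\<beta> k\<close> term.\<close>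
  have "\<alpha> i * (pt i \<bullet> A (p (Suc k))) = 0"
  proof -
    have "\<alpha> i * (pt i \<bullet> A (r (Suc k))) = rt i \<bullet> r (Suc k) - rt (Suc i) \<bullet> r (Suc k)"
      by (simp add: rt_Suc inner_diff_left adjoint)
    also have "\<dots> = (if i = k then - (rt (Suc k) \<bullet> r (Suc k)) else 0)"
      using r0[of i] r0[of "Suc i"] Suc.prems by auto
    finally have "\<alpha> i * (pt i \<bullet> A (r (Suc k))) =
        (if i = k then - (rt (Suc k) \<bullet> r (Suc k)) else 0)" .
    moreover have "\<alpha> i * (pt i \<bullet> A (p (Suc k))) =
        \<alpha> i * (pt i \<bullet> A (r (Suc k))) + \<beta> k * (\<alpha> i * (pt i \<bullet> A (p k)))"
      by (simp add: adjoint p_Suc inner_add_right algebra_simps)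
    moreover have "\<beta> k * (\<alpha> i * (pt i \<bullet> A (p k))) =
        (if i = k then rt (Suc k) \<bullet> r (Suc k) else 0)"
      using Suc.IH[of i] Suc.prems alpha_mult[OF k] beta_mult[OF k] by auto
    ultimately show ?thesis by simp
  qed
  then show ?case
    using r0[of i] alpha_nonzero[of i] Suc.prems by auto
qed

lemma rt_r_orthogonal: "\<lbrakk>i < k; k \<le> m\<rbrakk> \<Longrightarrow> rt i \<bullet> r k = 0"
  using rt_r_and_pt_A_p_upper by simp

lemma pt_A_p_orthogonal:
  assumes "i \<noteq> k" "i \<le> m" "k \<le> m"
  shows "pt i \<bullet> A (p k) = 0"
proof (cases "i < k")
  case True
  then show ?thesis using rt_r_and_pt_A_p_upper assms by simp
next
  case False
  then have "p k \<bullet> At (pt i) = 0"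
    using bicg.rt_r_and_pt_A_p_upper[OF dual] assms by simp
  then show ?thesis by (simp add: adjoint inner_commute)
qed

lemma pt_r_orthogonal: "\<lbrakk>i < k; k \<le> m\<rbrakk> \<Longrightarrow> pt i \<bullet> r k = 0"
  by (induction i) (simp_all add: pt_0 pt_Suc inner_add_left rt_r_orthogonal)

end

section \<open>Smoothed residuals as multiples of the directions\<close>

locale smoothed_bicg = bicg A At m r rt p pt \<alpha> \<beta>
  for A At :: "'v::real_inner \<Rightarrow> 'v" and m r rt p pt \<alpha> \<beta> +
  fixes s st u ut :: "nat \<Rightarrow> 'v" and \<eta> :: "nat \<Rightarrow> real"
  assumes s_0: "s 0 = r 0" and st_0: "st 0 = rt 0" and eta_0: "\<eta> 0 = 1"
    and u_Suc: "u (Suc k) = r (Suc k) - s k"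
    and ut_Suc: "ut (Suc k) = rt (Suc k) - st k"
    and s_Suc: "s (Suc k) = s k + \<eta> (Suc k) *\<^sub>R u (Suc k)"
    and st_Suc: "st (Suc k) = st k + \<eta> (Suc k) *\<^sub>R ut (Suc k)"
    and eta_Suc: "\<eta> (Suc k) =
      - ((st k \<bullet> u (Suc k) + s k \<bullet> ut (Suc k)) / (2 * (ut (Suc k) \<bullet> u (Suc k))))"
    and uu_nonzero: "k < m \<Longrightarrow> ut (Suc k) \<bullet> u (Suc k) \<noteq> 0"
begin

lemma dual_smoothed: "smoothed_bicg At A m rt r pt p \<alpha> \<beta> st s ut u \<eta>"
proof (intro smoothed_bicg.intro dual smoothed_bicg_axioms.intro)
  show "\<eta> (Suc k) =
      - ((s k \<bullet> ut (Suc k) + st k \<bullet> u (Suc k)) / (2 * (u (Suc k) \<bullet> ut (Suc k))))" for k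
    by (simp add: eta_Suc inner_commute add.commute)
  show "u (Suc k) \<bullet> ut (Suc k) \<noteq> 0" if "k < m" for k
    using uu_nonzero[OF that] by (simp add: inner_commute)
qed (fact s_0 st_0 eta_0 u_Suc ut_Suc s_Suc st_Suc)+

lemma s_convex: "s (Suc k) = (1 - \<eta> (Suc k)) *\<^sub>R s k + \<eta> (Suc k) *\<^sub>R r (Suc k)"
  by (simp add: s_Suc u_Suc algebra_simps)

lemma st_convex: "st (Suc k) = (1 - \<eta> (Suc k)) *\<^sub>R st k + \<eta> (Suc k) *\<^sub>R rt (Suc k)"
  by (simp add: st_Suc ut_Suc algebra_simps)

lemma st_r_orthogonal: "\<lbrakk>i < k; k \<le> m\<rbrakk> \<Longrightarrow> st i \<bullet> r k = 0"
  by (induction i) (simp_all add: st_0 st_convex inner_add_left rt_r_orthogonal)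

lemma rt_s_orthogonal: "\<lbrakk>i < k; k \<le> m\<rbrakk> \<Longrightarrow> rt k \<bullet> s i = 0"
  using smoothed_bicg.st_r_orthogonal[OF dual_smoothed] by (simp add: inner_commute)

lemma uu_eq:
  assumes "k < m"
  shows "ut (Suc k) \<bullet> u (Suc k) = rt (Suc k) \<bullet> r (Suc k) + st k \<bullet> s k"
  using assms st_r_orthogonal[of k "Suc k"] rt_s_orthogonal[of k "Suc k"]
  by (simp add: u_Suc ut_Suc inner_diff_left inner_diff_right)

text \<open>Both inner products in the numerator of \<open>\<eta> (Suc k)\<close> equal
  \<open>- (st k \<bullet> s k)\<close>, so the 2 cancels; the denominator is given by
  \<open>uu_eq\<close>.\<close>

lemma eta_mult:
  assumes "k < m"
  shows "\<eta> (Suc k) * (rt (Suc k) \<bullet> r (Suc k) + st k \<bullet> s k) = st k \<bullet> s k"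
proof -
  have "st k \<bullet> u (Suc k) = - (st k \<bullet> s k)" "s k \<bullet> ut (Suc k) = - (st k \<bullet> s k)"
    using assms st_r_orthogonal[of k "Suc k"] rt_s_orthogonal[of k "Suc k"]
    by (simp_all add: u_Suc ut_Suc inner_diff_right inner_commute)
  then have "\<eta> (Suc k) = (2 * (st k \<bullet> s k)) / (2 * (ut (Suc k) \<bullet> u (Suc k)))"
    by (simp add: eta_Suc)
  then show ?thesis
    using uu_nonzero[OF assms] by (simp flip: uu_eq[OF assms])
qed

text \<open>The third conjunct strengthens the induction: it evaluates
  \<open>st k \<bullet> s k\<close> as \<open>\<eta> k * (rt k \<bullet> r k)\<close>, which makes
  \<open>eta_mult\<close> a relation between \<open>\<eta>\<close> and
  \<open>\<beta>\<close>.\<close>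

lemma s_st_eq_scaled_p_pt:
  "k \<le> m \<Longrightarrow> s k = \<eta> k *\<^sub>R p k \<and> st k = \<eta> k *\<^sub>R pt k \<and> st k \<bullet> p k = rt k \<bullet> r k"
proof (induction k)
  case 0
  then show ?case by (simp add: s_0 st_0 p_0 pt_0 eta_0)
next
  case (Suc k)
  then have k: "k < m" and s: "s k = \<eta> k *\<^sub>R p k" and st: "st k = \<eta> k *\<^sub>R pt k"
    and sp: "st k \<bullet> p k = rt k \<bullet> r k" by auto
  let ?e = "\<eta> (Suc k)" and ?\<rho> = "rt k \<bullet> r k" and ?\<rho>' = "rt (Suc k) \<bullet> r (Suc k)"
  have "?e * (?\<rho>' + \<eta> k * ?\<rho>) = \<eta> k * ?\<rho>"
    using eta_mult[OF k] sp by (simp add: s)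
  then have "(1 - ?e) * \<eta> k * ?\<rho> = ?e * ?\<rho>'"
    by (simp add: algebra_simps)
  then have "(1 - ?e) * \<eta> k * ?\<rho> = ?e * \<beta> k * ?\<rho>"
    by (simp add: beta_mult[OF k, symmetric])
  \<comment> \<open>This matches the coefficients of \<open>p k\<close> in \<open>s_convex\<close>
    and in \<open>\<eta> (Suc k) *\<^sub>R p (Suc k)\<close>; those of \<open>r (Suc k)\<close>
    agree already.\<close>
  then have e: "(1 - ?e) * \<eta> k = ?e * \<beta> k"
    using rho_nonzero[OF k] by simp
  have "rt (Suc k) \<bullet> p k = 0"
    using bicg.pt_r_orthogonal[OF dual, of k "Suc k"] k by (simp add: inner_commute)
  then have "st (Suc k) \<bullet> p (Suc k) = ?e * ?\<rho>' + (1 - ?e) * (\<beta> k * ?\<rho>)"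
    using sp st_r_orthogonal[of k "Suc k"] k
    by (simp add: st_convex p_Suc inner_add_left inner_add_right)
  then have "st (Suc k) \<bullet> p (Suc k) = ?\<rho>'"
    by (simp add: beta_mult[OF k] algebra_simps)
  then show ?case
    by (simp add: s_convex st_convex p_Suc pt_Suc scaleR_add_right s st e)
qed

lemma st_A_s_orthogonal:
  assumes "i \<noteq> j" "i \<le> m" "j \<le> m"
  shows "At (st j) \<bullet> s i = 0"
proof -
  have "At (st j) \<bullet> s i = \<eta> i * (st j \<bullet> A (p i))"
    using s_st_eq_scaled_p_pt[OF assms(2)] by (simp add: adjoint)
  also have "\<dots> = \<eta> i * (\<eta> j * (pt j \<bullet> A (p i)))"
    using s_st_eq_scaled_p_pt[OF assms(3)] by simp
  finally show ?thesis using pt_A_p_orthogonal[of j i] assms by simp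
qed

section \<open>Biorthogonality of the smoothing updates\<close>

lemma rt_u_orthogonal:
  assumes "1 \<le> i" "i < k" "k \<le> m"
  shows "rt k \<bullet> u i = 0"
proof -
  obtain l where "i = Suc l" using assms(1) by (cases i) auto
  moreover have "rt k \<bullet> r i = 0"
    using bicg.rt_r_orthogonal[OF dual] assms by (simp add: inner_commute)
  ultimately show ?thesis
    using rt_s_orthogonal assms by (simp add: u_Suc inner_diff_right)
qed

text \<open>At \<open>k = i\<close> the product vanishes by \<open>eta_mult\<close>, that is, by the
  choice of \<open>\<eta> i\<close>. Each later \<open>st k\<close> is a combination of
  \<open>st i\<close> and residuals \<open>rt\<close> of index above \<open>i\<close>, all
  orthogonal to \<open>u i\<close>.\<close>

lemma st_u_orthogonal:
  assumes "1 \<le> i" "i \<le> k" "k \<le> m"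
  shows "st k \<bullet> u i = 0"
  using assms(2,3)
proof (induction k rule: dec_induct)
  case base
  obtain l where i: "i = Suc l" and l: "l < m" using assms by (cases i) auto
  have "st i \<bullet> u i = \<eta> i * (rt i \<bullet> r i) - (1 - \<eta> i) * (st l \<bullet> s l)"
    using st_r_orthogonal[of l i] rt_s_orthogonal[of l i] l
    by (simp add: i u_Suc st_convex inner_add_left inner_diff_right)
  then show ?case using eta_mult[OF l] by (simp add: i algebra_simps)
next
  case (step k)
  then show ?case
    using rt_u_orthogonal[of i "Suc k"] assms(1) by (simp add: st_convex inner_add_left)
qed

lemma ut_u_upper_orthogonal:
  assumes "1 \<le> i" "i < j" "j \<le> m"
  shows "ut j \<bullet> u i = 0"
proof -
  obtain l where "j = Suc l" using assms by (cases j) auto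
  then show ?thesis
    using rt_u_orthogonal[of i j] st_u_orthogonal[of i l] assms
    by (simp add: ut_Suc inner_diff_left)
qed

lemma u_ut_orthogonal:
  assumes "i \<noteq> j" "1 \<le> i" "i \<le> m" "1 \<le> j" "j \<le> m"
  shows "u i \<bullet> ut j = 0"
  using assms ut_u_upper_orthogonal[of i j]
    smoothed_bicg.ut_u_upper_orthogonal[OF dual_smoothed, of j i]
  by (cases "i < j") (simp_all add: inner_commute)

end

text \<open>The recurrences hold at every index by definition, division being total;
  \<open>no_breakdown\<close> supplies the nonvanishing conditions below \<open>m\<close>. The value
  1 at index 0, which the algorithm leaves undefined, gives
  \<open>s 0 = \<eta> 0 *\<^sub>R p 0\<close>.\<close>

lemma iterate_smoothed_bicg:
  fixes A :: "real^'n^'n" and b x0 rt0 :: "real^'n"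
  defines "\<sigma> \<equiv> iterate A b x0 rt0"
  assumes "no_breakdown A b x0 rt0 m"
  shows "smoothed_bicg ((*v) A) ((*v) (transpose A)) m
    (\<lambda>k. state.r (\<sigma> k)) (\<lambda>k. state.rt (\<sigma> k)) (\<lambda>k. state.p (\<sigma> k)) (\<lambda>k. state.pt (\<sigma> k))
    (\<lambda>k. (state.rt (\<sigma> k) \<bullet> state.r (\<sigma> k)) / (state.pt (\<sigma> k) \<bullet> (A *v state.p (\<sigma> k))))
    (\<lambda>k. (state.rt (\<sigma> (Suc k)) \<bullet> state.r (\<sigma> (Suc k))) / (state.rt (\<sigma> k) \<bullet> state.r (\<sigma> k)))
    (\<lambda>k. state.s (\<sigma> k)) (\<lambda>k. state.st (\<sigma> k)) (\<lambda>k. state.u (\<sigma> k)) (\<lambda>k. state.ut (\<sigma> k))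
    (\<lambda>k. case k of 0 \<Rightarrow> 1 | Suc l \<Rightarrow>
      - ((state.st (\<sigma> l) \<bullet> state.u (\<sigma> (Suc l)) + state.s (\<sigma> l) \<bullet> state.ut (\<sigma> (Suc l))) /
         (2 * (state.ut (\<sigma> (Suc l)) \<bullet> state.u (\<sigma> (Suc l))))))"
proof -
  have \<sigma>_0: "\<sigma> 0 = init A b x0 rt0" and \<sigma>_Suc: "\<sigma> (Suc k) = step A (\<sigma> k)" for k
    by (simp_all add: \<sigma>_def)
  have nb: "state.rt (\<sigma> k) \<bullet> state.r (\<sigma> k) \<noteq> 0"
    "state.pt (\<sigma> k) \<bullet> (A *v state.p (\<sigma> k)) \<noteq> 0"
    "state.ut (\<sigma> (Suc k)) \<bullet> state.u (\<sigma> (Suc k)) \<noteq> 0" if "k < m" for k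
    using assms(2) that unfolding no_breakdown_def Let_def \<sigma>_def by blast+
  show ?thesis
  proof (unfold_locales, goal_cases)
    case (1 v w)
    show ?case by (simp add: dot_lmul_matrix)
  \<comment> \<open>The nonvanishing goals come first, while \<open>\<sigma> (Suc k)\<close> is
    still folded and \<open>nb\<close> matches.\<close>
  qed (simp_all add: nb, simp_all add: \<sigma>_0 \<sigma>_Suc init_def step_def Let_def)
qed

theorem mainTheorem2:
  fixes A :: "real^'n^'n" and b x0 rt0 :: "real^'n" and m :: nat
    and s st u ut :: "nat \<Rightarrow> real^'n"
  assumes "transpose A \<noteq> A"
    and "invertible A"
    and "rt0 \<bullet> (b - A *v x0) \<noteq> 0"
    and "1 \<le> m" and "m \<le> CARD('n)"
    and "no_breakdown A b x0 rt0 m"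
    and "s = (\<lambda>k. state.s (iterate A b x0 rt0 k))"
    and "st = (\<lambda>k. state.st (iterate A b x0 rt0 k))"
    and "u = (\<lambda>k. state.u (iterate A b x0 rt0 k))"
    and "ut = (\<lambda>k. state.ut (iterate A b x0 rt0 k))"
  shows "(\<forall>i j. i \<noteq> j \<and> i \<le> m \<and> j \<le> m \<and> i < CARD('n) \<and> j < CARD('n) \<longrightarrow>
            s i \<bullet> (transpose A *v st j) = 0) \<and>
         (\<forall>i j. i \<noteq> j \<and> 1 \<le> i \<and> i \<le> m \<and> 1 \<le> j \<and> j \<le> m \<longrightarrow>
            u i \<bullet> ut j = 0)"
proof -
  note smoothed = iterate_smoothed_bicg[OF assms(6)]
  show ?thesis
    using smoothed_bicg.st_A_s_orthogonal[OF smoothed]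
      smoothed_bicg.u_ut_orthogonal[OF smoothed]
    unfolding assms(7-10) by (simp add: inner_commute)
qed

end
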